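(* A subset of $\mathbb{R}_{\max}^n$ is a tropical polyhedron with mixed constraints if, and only if, it is the intersection of finitely many tropical hemispaces of $\mathbb{R}_{\max}^n$.
   Context: $\mathbb{R}_{\max}=\mathbb{R}\cup\{-\infty\}$ is the max-plus semiring ($x\oplus y=\max(x,y)$, $x\otimes y=xy=x+y$), and $\overline{\mathbb{R}}_{\max}=\mathbb{R}_{\max}\cup\{+\infty\}$. Let $\mathbb{R}^-=\{\alpha^-:\alpha\in\mathbb{R}\}$ be a disjoint copy of $\mathbb{R}$ and $\mathbb{G}=\overline{\mathbb{R}}_{\max}\cup\mathbb{R}^-$. The modulus is $|x|=x$ for $x\in\overline{\mathbb{R}}_{\max}$ and $|\alpha^-|=\alpha$. The total order $\leq_{\mathbb{G}}$ is: $x\leq_{\mathbb{G}}y$ iff $|x|<|y|$ when $x\in\overline{\mathbb{R}}_{\max}$ and $y\in\mathbb{R}^-$, and $|x|\le|y|$ in all other cases. $\mathbb{G}$ is a semiring where $x\oplus y$ is the greater of $x,y$ for $\leq_{\mathbb{G}}$, and $xy$ is: $x+y$ if $x,y\in\mathbb{R}$; $(|x|+|y|)^-$ if $x\in\mathbb{R}^-$ or $y\in\mathbb{R}^-$ and both are different from $\pm\infty$; $-\infty$ if $x=-\infty$ or $y=-\infty$; $+\infty$ if neither is $-\infty$ and at least one is $+\infty$. A mixed tropical affine inequality is a constraint $a_0\oplus a_1\mathbf{x}_1\oplus\cdots\oplus a_n\mathbf{x}_n\leq_{\mathbb{G}}b_0\oplus b_1\mathbf{x}_1\oplus\cdots\oplus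 b_n\mathbf{x}_n$ with $a_i\in\mathbb{R}_{\max}$ and $b_i\in\mathbb{G}$. A tropical polyhedron with mixed constraints is the set of $\mathbf{x}\in\mathbb{R}_{\max}^n$ satisfying finitely many mixed tropical affine inequalities. A subset $\mathcal{C}\subset\mathbb{R}_{\max}^n$ is tropically convex if $\lambda\mathbf{x}\oplus\mu\mathbf{y}\in\mathcal{C}$ for all $\mathbf{x},\mathbf{y}\in\mathcal{C}$ and $\lambda,\mu\in\mathbb{R}_{\max}$ with $\lambda\oplus\mu=0$. A tropical hemispace is a tropically convex set whose complement in $\mathbb{R}_{\max}^n$ is also tropically convex. *)

theory Defs
  imports "HOL-Analysis.Finite_Cartesian_Product" "HOL-Library.Extended_Real"
begin

text \<open>
  The max-plus semiring is carried by the extended reals without \<open>\<infinity>\<close>, with \<^const>\<open>max\<close> as addition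
  and \<open>+\<close> as multiplication.  On this carrier, \<open>+\<close> of extended reals has \<open>-\<infinity>\<close> as absorbing
  element; in the library \<open>-\<infinity> + \<infinity> = \<infinity>\<close>, so the product involving \<open>\<infinity>\<close> is defined separately below.
\<close>

definition rmax :: "ereal set" where
  "rmax = {x. x \<noteq> \<infinity>}"

definition rmax_space :: "(ereal ^ 'n) set" where
  "rmax_space = {x. \<forall>i. x $ i \<in> rmax}"

text \<open>
  The semiring of germs: \<open>Plain x\<close> is the extended real \<open>x\<close> itself, \<open>Minus \<alpha>\<close> is the copy
  \<open>\<alpha>\<^sup>-\<close> of the real number \<open>\<alpha>\<close>.
\<close>

datatype germ = Plain ereal | is_Minus: Minus real

fun modulus :: "germ \<Rightarrow> ereal" where
  "modulus (Plain x) = x"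
| "modulus (Minus \<alpha>) = ereal \<alpha>"

instantiation germ :: linorder
begin

definition less_eq_germ :: "germ \<Rightarrow> germ \<Rightarrow> bool" where
  "x \<le> y \<longleftrightarrow> (if \<not> is_Minus x \<and> is_Minus y then modulus x < modulus y else modulus x \<le> modulus y)"

definition less_germ :: "germ \<Rightarrow> germ \<Rightarrow> bool" where
  "x < y \<longleftrightarrow> x \<le> y \<and> \<not> y \<le> (x :: germ)"

instance
proof
  fix x y z :: germ
  show "x < y \<longleftrightarrow> x \<le> y \<and> \<not> y \<le> x"
    by (rule less_germ_def)
  show "x \<le> x"
    by (simp add: less_eq_germ_def)
  show "x \<le> z" if "x \<le> y" "y \<le> z"
    using that by (auto simp: less_eq_germ_def split: if_splits)
  show "x = y" if "x \<le> y" "y \<le> x"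
    using that by (cases x; cases y) (auto simp: less_eq_germ_def)
  show "x \<le> y \<or> y \<le> x"
    by (auto simp: less_eq_germ_def)
qed

end

text \<open>The class operations \<open>+\<close>, \<open>*\<close>, \<open>0\<close>, \<open>1\<close> on germs are the tropical ones.\<close>

instantiation germ :: comm_semiring_1
begin

definition zero_germ :: germ where
  "0 = Plain (-\<infinity>)"

definition one_germ :: germ where
  "1 = Plain 0"

definition plus_germ :: "germ \<Rightarrow> germ \<Rightarrow> germ" where
  "x + y = max x (y :: germ)"

definition times_germ :: "germ \<Rightarrow> germ \<Rightarrow> germ" where
  "x * y =
    (if x = Plain (-\<infinity>) \<or> y = Plain (-\<infinity>) then Plain (-\<infinity>)
     else if x = Plain \<infinity> \<or> y = Plain \<infinity> then Plain \<infinity>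
     else if is_Minus x \<or> is_Minus y then Minus (real_of_ereal (modulus x + modulus y))
     else Plain (modulus x + modulus y))"

lemma germ_exhaust_cases:
  obtains "x = Plain (-\<infinity>)" | "x = Plain \<infinity>" | r where "x = Plain (ereal r)" | r where "x = Minus r"
  by (metis germ.exhaust ereal_cases)

instance
proof
  fix x y z :: germ
  show "x + y + z = x + (y + z)"
    by (simp add: plus_germ_def max.assoc)
  show "x + y = y + x"
    by (simp add: plus_germ_def max.commute)
  show "0 + x = x"
    by (cases x rule: germ_exhaust_cases)
       (auto simp: plus_germ_def zero_germ_def max_def less_eq_germ_def)
  show "x * y * z = x * (y * z)"
    by (cases x rule: germ_exhaust_cases; cases y rule: germ_exhaust_cases;
        cases z rule: germ_exhaust_cases) (auto simp: times_germ_def)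
  show "x * y = y * x"
    by (auto simp: times_germ_def add.commute)
  show "1 * x = x"
    by (cases x rule: germ_exhaust_cases) (auto simp: times_germ_def one_germ_def zero_ereal_def)
  show "(x + y) * z = x * z + y * z"
    by (cases x rule: germ_exhaust_cases; cases y rule: germ_exhaust_cases;
        cases z rule: germ_exhaust_cases)
       (auto simp: times_germ_def plus_germ_def max_def less_eq_germ_def)
  show "0 * x = 0" "x * 0 = 0"
    by (auto simp: times_germ_def zero_germ_def)
  show "(0 :: germ) \<noteq> 1"
    by (simp add: zero_germ_def one_germ_def)
qed

end

definition sat_mixed_ineq ::
  "ereal \<Rightarrow> ereal ^ 'n \<Rightarrow> germ \<Rightarrow> germ ^ 'n \<Rightarrow> ereal ^ 'n \<Rightarrow> bool" where
  "sat_mixed_ineq a0 a b0 b x \<longleftrightarrow>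
    Plain a0 + (\<Sum>i\<in>UNIV. Plain (a $ i) * Plain (x $ i)) \<le> b0 + (\<Sum>i\<in>UNIV. b $ i * Plain (x $ i))"

definition mixed_polyhedron :: "(ereal ^ 'n) set \<Rightarrow> bool" where
  "mixed_polyhedron P \<longleftrightarrow>
    (\<exists>I :: (ereal \<times> (ereal ^ 'n) \<times> germ \<times> (germ ^ 'n)) set.
      finite I \<and> (\<forall>(a0, a, b0, b)\<in>I. a0 \<in> rmax \<and> a \<in> rmax_space) \<and>
      P = {x \<in> rmax_space. \<forall>(a0, a, b0, b)\<in>I. sat_mixed_ineq a0 a b0 b x})"

definition tropically_convex :: "(ereal ^ 'n) set \<Rightarrow> bool" where
  "tropically_convex C \<longleftrightarrow> C \<subseteq> rmax_space \<and>
    (\<forall>x\<in>C. \<forall>y\<in>C. \<forall>l\<in>rmax. \<forall>m\<in>rmax. max l m = 0 \<longrightarrow> (\<chi> i. max (l + x $ i) (m + y $ i)) \<in> C)"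

definition tropical_hemispace :: "(ereal ^ 'n) set \<Rightarrow> bool" where
  "tropical_hemispace H \<longleftrightarrow> tropically_convex H \<and> tropically_convex (rmax_space - H)"

end

theory Submission
  imports Defs
begin

text \<open>
  The solution set of one mixed inequality \<open>f \<le> g\<close> is a hemispace because \<open>f\<close> and \<open>g\<close> commute
  with tropical convex combinations and both \<open>\<le>\<close> and \<open>>\<close> survive taking maxima.

  Conversely, homogenize a hemispace to a cone \<open>V\<close> with one more coordinate, declaring a direction
  \<open>y\<close> at infinity to be in \<open>V\<close> if \<open>\<lambda> y\<close> eventually stays in the hemispace; the complement
  \<open>W\<close> of \<open>V\<close> is then a cone as well.  Writing a vector as the supremum of its restrictions to pairs
  of coordinates shows that it lies in \<open>V\<close> iff for every unit vector \<open>e\<^sub>i \<in> W\<close> with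
  \<open>x\<^sub>i \<noteq> -\<infinity>\<close> there is some \<open>e\<^sub>j \<in> V\<close> with \<open>x\<^sub>i e\<^sub>i \<oplus> x\<^sub>j e\<^sub>j \<in> V\<close>.
  In the plane of \<open>i\<close> and \<open>j\<close> the cone \<open>V\<close> is given by a down-closed set of differences
  \<open>x\<^sub>i - x\<^sub>j\<close>, that is, by a condition \<open>x\<^sub>i \<le> \<alpha>\<^sub>i\<^sub>j x\<^sub>j\<close> with a germ \<open>\<alpha>\<^sub>i\<^sub>j\<close>.
\<close>

section \<open>Germs\<close>

lemma Plain_max: "Plain (max x y) = Plain x + Plain y"
  by (auto simp: plus_germ_def max_def less_eq_germ_def)

lemma Plain_add:
  assumes "x \<in> rmax" "y \<in> rmax"
  shows "Plain (x + y) = Plain x * Plain y"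
  using assms by (cases x; cases y) (auto simp: times_germ_def rmax_def)

lemma germ_mult_left_mono: "x \<le> y \<Longrightarrow> c * x \<le> c * (y :: germ)"
  by (metis distrib_left max.absorb_iff2 plus_germ_def)

lemma germ_mult_strict_left_mono:
  assumes "x < y" "y \<noteq> Plain \<infinity>"
  shows "Plain (ereal r) * x < Plain (ereal r) * y"
  using assms
  by (cases x rule: germ_exhaust_cases; cases y rule: germ_exhaust_cases)
     (auto simp: times_germ_def less_germ_def less_eq_germ_def)

lemma germ_zero_le: "0 \<le> (x :: germ)"
  by (cases x rule: germ_exhaust_cases) (auto simp: zero_germ_def less_eq_germ_def)

text \<open>A sum of germs is a maximum in a linear order, so it dominates \<open>p\<close> exactly
  when one summand does. The alternative \<open>p = 0\<close> accounts for the empty sum, which is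
  the least germ.\<close>

lemma le_sum_germ_iff:
  fixes p :: germ
  assumes "finite A"
  shows "p \<le> sum f A \<longleftrightarrow> p = 0 \<or> (\<exists>j\<in>A. p \<le> f j)"
  using assms
proof (induction A rule: finite_induct)
  case empty
  then show ?case using germ_zero_le[of p] by auto
next
  case (insert a A)
  have "p \<le> sum f (insert a A) \<longleftrightarrow> p \<le> f a \<or> p \<le> sum f A"
    using insert by (simp add: plus_germ_def le_max_iff_disj)
  then show ?case using insert by auto
qed

text \<open>A down-closed set of reals is empty, everything, a closed ray or an open ray. These four
  shapes are the four kinds of germ: \<open>Plain (-\<infinity>)\<close>,
  \<open>Plain \<infinity>\<close>, \<open>Plain m\<close> if the supremum \<open>m\<close> is
  attained, and \<open>Minus m\<close> if it is not, since a plain germ below \<open>Minus m\<close>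
  must have strictly smaller modulus.\<close>

lemma ex_germ_downset:
  fixes D :: "real set"
  assumes down: "\<And>d d'. d \<in> D \<Longrightarrow> d' \<le> d \<Longrightarrow> d' \<in> D"
  shows "\<exists>\<alpha>. \<forall>s t. Plain (ereal s) \<le> \<alpha> * Plain (ereal t) \<longleftrightarrow> s - t \<in> D"
proof -
  consider "D = {}" | "D = UNIV" | "D \<noteq> {}" "bdd_above D"
    using down by (metis UNIV_eq_I bdd_above.I linorder_le_cases)
  then show ?thesis
  proof cases
    case 1
    then show ?thesis
      by (intro exI[of _ "Plain (-\<infinity>)"]) (auto simp: times_germ_def less_eq_germ_def)
  next
    case 2
    then show ?thesis
      by (intro exI[of _ "Plain \<infinity>"]) (auto simp: times_germ_def less_eq_germ_def)
  next
    case 3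
    define m where "m = Sup D"
    have below: "d \<in> D" if "d < m" for d
      using that 3 down less_cSup_iff[of D d] unfolding m_def by (meson less_imp_le)
    have above: "d \<le> m" if "d \<in> D" for d
      using that 3 cSup_upper unfolding m_def by blast
    show ?thesis
    proof (cases "m \<in> D")
      case True
      then have "d \<in> D \<longleftrightarrow> d \<le> m" for d
        using below above by (metis down)
      then show ?thesis
        by (intro exI[of _ "Plain (ereal m)"])
           (auto simp: times_germ_def less_eq_germ_def algebra_simps)
    next
      case False
      then have "d \<in> D \<longleftrightarrow> d < m" for d
        using below above by (metis order_le_less)
      then show ?thesis
        by (intro exI[of _ "Minus m"])
           (auto simp: times_germ_def less_eq_germ_def algebra_simps)
    qed
  qed
qed

section \<open>Mixed inequalities define hemispaces\<close>

lemma tropically_convexD: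
  assumes "tropically_convex C" "x \<in> C" "y \<in> C" "l \<in> rmax" "m \<in> rmax" "max l m = 0"
  shows "(\<chi> i. max (l + x $ i) (m + y $ i)) \<in> C"
  using assms unfolding tropically_convex_def by blast

lemma add_mem_rmax: "x \<in> rmax \<Longrightarrow> y \<in> rmax \<Longrightarrow> x + y \<in> rmax"
  by (simp add: rmax_def)

lemma max_mem_rmax: "x \<in> rmax \<Longrightarrow> y \<in> rmax \<Longrightarrow> max x y \<in> rmax"
  by (simp add: max_def)

lemma rmax_space_combination:
  assumes "x \<in> rmax_space" "y \<in> rmax_space" "l \<in> rmax" "m \<in> rmax"
  shows "(\<chi> i. max (l + x $ i) (m + y $ i)) \<in> rmax_space"
  using assms by (auto simp: rmax_space_def intro!: max_mem_rmax add_mem_rmax)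

definition affine_germ :: "germ \<Rightarrow> germ ^ 'n \<Rightarrow> ereal ^ 'n \<Rightarrow> germ" where
  "affine_germ b0 b x = b0 + (\<Sum>i\<in>UNIV. b $ i * Plain (x $ i))"

lemma sat_mixed_ineq_affine_germ:
  "sat_mixed_ineq a0 a b0 b x \<longleftrightarrow>
    affine_germ (Plain a0) (\<chi> i. Plain (a $ i)) x \<le> affine_germ b0 b x"
  by (simp add: sat_mixed_ineq_def affine_germ_def)

lemma affine_germ_combination:
  assumes "x \<in> rmax_space" "y \<in> rmax_space" "l \<in> rmax" "m \<in> rmax" "max l m = 0"
  shows "affine_germ b0 b (\<chi> i. max (l + x $ i) (m + y $ i)) =
    Plain l * affine_germ b0 b x + Plain m * affine_germ b0 b y"
proof -
  \<comment> \<open>The normalization of the weights says that they add up to the tropical one; this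
    is what lets the constant term be split between \<open>x\<close> and \<open>y\<close>.\<close>
  have one: "Plain l + Plain m = 1"
    using assms by (simp add: Plain_max[symmetric] one_germ_def)
  have b0: "b0 = Plain l * b0 + Plain m * b0"
    by (metis one distrib_right mult_1)
  have "b $ i * Plain (max (l + x $ i) (m + y $ i)) =
      Plain l * (b $ i * Plain (x $ i)) + Plain m * (b $ i * Plain (y $ i))" for i
    using assms by (simp add: Plain_max Plain_add rmax_space_def algebra_simps)
  then show ?thesis
    unfolding affine_germ_def
    by (subst b0) (simp add: sum.distrib sum_distrib_left distrib_left ac_simps)
qed

text \<open>Each term of this maximum is built from elements of \<open>rmax\<close> and so stays
  below \<infinity>. This supplies the premise of \<open>germ_mult_strict_left_mono\<close> about
  the larger side.\<close>

lemma affine_germ_Plain_ne_infinity: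
  assumes "a0 \<in> rmax" "a \<in> rmax_space" "x \<in> rmax_space"
  shows "affine_germ (Plain a0) (\<chi> i. Plain (a $ i)) x \<noteq> Plain \<infinity>"
proof
  assume eq: "affine_germ (Plain a0) (\<chi> i. Plain (a $ i)) x = Plain \<infinity>"
  have prod: "Plain (a $ i) * Plain (x $ i) = Plain (a $ i + x $ i)" for i
    using assms by (simp add: Plain_add rmax_space_def)
  have "\<not> Plain \<infinity> \<le> Plain z" if "z \<in> rmax" for z
    using that by (simp add: less_eq_germ_def rmax_def)
  moreover have "a $ i + x $ i \<in> rmax" for i
    using assms by (simp add: rmax_space_def add_mem_rmax)
  moreover have "Plain \<infinity> \<le> Plain a0 + (\<Sum>i\<in>UNIV. Plain (a $ i + x $ i))"
    using eq by (simp add: affine_germ_def prod)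
  ultimately show False
    using assms
    by (auto simp: plus_germ_def le_max_iff_disj le_sum_germ_iff zero_germ_def)
qed

lemma tropical_hemispace_mixed_ineq:
  fixes a :: "ereal ^ 'n"
  assumes a: "a0 \<in> rmax" "a \<in> rmax_space"
  shows "tropical_hemispace {x \<in> rmax_space. sat_mixed_ineq a0 a b0 b x}"
proof -
  let ?f = "affine_germ (Plain a0) (\<chi> i. Plain (a $ i))" and ?g = "affine_germ b0 b"
  let ?c = "\<lambda>l m x y :: ereal ^ 'n. \<chi> i. max (l + x $ i) (m + y $ i)"
  have le: "?f (?c l m x y) \<le> ?g (?c l m x y)"
    if "x \<in> rmax_space" "y \<in> rmax_space" "?f x \<le> ?g x" "?f y \<le> ?g y"
      "l \<in> rmax" "m \<in> rmax" "max l m = 0" for l m x y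
    using that
    by (simp add: affine_germ_combination)
       (metis germ_mult_left_mono max.mono plus_germ_def)
  \<comment> \<open>A strict inequality survives multiplication by a real scalar, whereas the weight
    -\<infinity> collapses both sides to \<open>0\<close>.\<close>
  have scaled: "(c = -\<infinity> \<and> Plain c * ?f x = 0 \<and> Plain c * ?g x = 0) \<or>
      Plain c * ?g x < Plain c * ?f x"
    if "c \<in> rmax" "x \<in> rmax_space" "?g x < ?f x" for c x
    using that affine_germ_Plain_ne_infinity[OF a that(2)]
    by (cases c) (auto simp: rmax_def germ_mult_strict_left_mono zero_germ_def[symmetric])
  have less: "?g (?c l m x y) < ?f (?c l m x y)"
    if "x \<in> rmax_space" "y \<in> rmax_space" "?g x < ?f x" "?g y < ?f y"
      "l \<in> rmax" "m \<in> rmax" "max l m = 0" for l m x y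
  proof -
    \<comment> \<open>At least one weight is real, so at least one of the two scaled inequalities is
      still strict, and a collapsed term does not affect the maximum.\<close>
    have "l \<noteq> -\<infinity> \<or> m \<noteq> -\<infinity>"
      using that by auto
    then have "Plain l * ?g x + Plain m * ?g y < Plain l * ?f x + Plain m * ?f y"
      using scaled[OF that(5,1,3)] scaled[OF that(6,2,4)]
      by (auto simp: plus_germ_def less_max_iff_disj intro: le_less_trans[OF germ_zero_le])
    then show ?thesis using that by (simp add: affine_germ_combination)
  qed
  show ?thesis
    unfolding tropical_hemispace_def tropically_convex_def
    by (auto simp: sat_mixed_ineq_affine_germ rmax_space_combination not_le intro: le less)
qed

section \<open>Complementary cones\<close>

text \<open>Vectors are functions, so that tropical addition is the pointwise \<open>sup\<close>.
  Scaling is by reals only: the vector with all entries -\<infinity> may belong to either set,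
  though not to both.\<close>

locale complementary_cones =
  fixes V W :: "('m :: finite \<Rightarrow> ereal) set"
  assumes cover: "(\<forall>k. x k \<in> rmax) \<Longrightarrow> x \<in> V \<or> x \<in> W"
    and disjoint: "V \<inter> W = {}"
    and sup_V: "x \<in> V \<Longrightarrow> y \<in> V \<Longrightarrow> sup x y \<in> V"
    and sup_W: "x \<in> W \<Longrightarrow> y \<in> W \<Longrightarrow> sup x y \<in> W"
    and shift_V: "x \<in> V \<Longrightarrow> (\<lambda>k. ereal r + x k) \<in> V"
    and shift_W: "x \<in> W \<Longrightarrow> (\<lambda>k. ereal r + x k) \<in> W"
begin

definition unit :: "'m \<Rightarrow> 'm \<Rightarrow> ereal" where
  "unit i = (\<lambda>k. if k = i then 0 else -\<infinity>)"

definition pair :: "('m \<Rightarrow> ereal) \<Rightarrow> 'm \<Rightarrow> 'm \<Rightarrow> 'm \<Rightarrow> ereal" where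
  "pair x i j = (\<lambda>k. if k = i \<or> k = j then x k else -\<infinity>)"

text \<open>The family must be nonempty because the empty supremum is the vector with all entries
  -\<infinity>, which may lie in \<open>W\<close>.\<close>

lemma Sup_V: "finite F \<Longrightarrow> F \<noteq> {} \<Longrightarrow> F \<subseteq> V \<Longrightarrow> Sup F \<in> V"
  by (induction F rule: finite_ne_induct) (auto intro: sup_V)

lemma Sup_W: "finite F \<Longrightarrow> F \<noteq> {} \<Longrightarrow> F \<subseteq> W \<Longrightarrow> Sup F \<in> W"
  by (induction F rule: finite_ne_induct) (auto intro: sup_W)

lemma pair_same: "x i = ereal r \<Longrightarrow> pair x i i = (\<lambda>k. ereal r + unit i k)"
  by (auto simp: pair_def unit_def)

lemma pair_sup: "pair x i j = sup (pair x i i) (pair x j j)"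
  by (auto simp: pair_def fun_eq_iff)

text \<open>Restrictions lie below \<open>x\<close>, and every entry other than -\<infinity> is
  attained by some member of \<open>F\<close>.\<close>

lemma Sup_pairs:
  assumes "F \<subseteq> {pair x i j | i j. True}"
    and "\<And>k. x k \<noteq> -\<infinity> \<Longrightarrow> \<exists>i. pair x k i \<in> F \<or> pair x i k \<in> F"
  shows "Sup F = x"
proof (rule antisym)
  show "Sup F \<le> x"
    using assms(1) by (intro Sup_least) (auto simp: pair_def le_fun_def)
  show "x \<le> Sup F"
  proof (rule le_funI)
    fix k
    show "x k \<le> Sup F k"
    proof (cases "x k = -\<infinity>")
      case False
      then obtain p where "p \<in> F" "p k = x k"
        using assms(2)[of k] by (auto simp: pair_def)
      then show ?thesis by (metis Sup_upper le_funD)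
    qed simp
  qed
qed

lemma finite_pairs: "finite {pair x i j | i j. True}"
  by (rule finite_surj[of UNIV _ "\<lambda>(i, j). pair x i j"]) auto

text \<open>Both directions exhibit \<open>x\<close> as the supremum of a nonempty family of
  restrictions inside a single cone. The premise \<open>nz\<close> excludes the vector with all
  entries -\<infinity>, which satisfies the right side vacuously but may lie in
  \<open>W\<close>.\<close>

lemma mem_V_iff:
  assumes x: "\<forall>k. x k \<in> rmax" and nz: "x k0 \<noteq> -\<infinity>"
  shows "x \<in> V \<longleftrightarrow>
    (\<forall>i. unit i \<in> W \<longrightarrow> x i = -\<infinity> \<or> (\<exists>j. unit j \<in> V \<and> pair x i j \<in> V))" (is "_ \<longleftrightarrow> ?R")
proof
  have real: "\<exists>r. x k = ereal r" if "x k \<noteq> -\<infinity>" for k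
    using x that by (cases "x k") (auto simp: rmax_def dest: spec[of _ k])
  have unit: "unit k \<in> V \<or> unit k \<in> W" for k
    by (rule cover) (simp add: unit_def rmax_def)
  have pair: "pair x i j \<in> V \<or> pair x i j \<in> W" for i j
    using x by (intro cover) (simp add: pair_def rmax_def)
  have V: "pair x k k \<in> V" if "unit k \<in> V" "x k \<noteq> -\<infinity>" for k
    using real[OF that(2)] that(1) by (auto simp: pair_same intro: shift_V)
  have W: "pair x k k \<in> W" if "unit k \<in> W" "x k \<noteq> -\<infinity>" for k
    using real[OF that(2)] that(1) by (auto simp: pair_same intro: shift_W)
  show "x \<in> V" if ?R
  proof -
    let ?F = "{pair x i j | i j. True} \<inter> V"
    \<comment> \<open>If \<open>unit k\<close> is in \<open>V\<close>, the single-coordinate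
      restriction \<open>pair x k k\<close> covers \<open>k\<close>; otherwise \<open>?R\<close>
      provides a partner.\<close>
    have covered: "\<exists>i. pair x k i \<in> ?F \<or> pair x i k \<in> ?F" if "x k \<noteq> -\<infinity>" for k
      using unit[of k] V[OF _ that] \<open>?R\<close> that by blast
    have "?F \<noteq> {}" using covered[OF nz] by blast
    then have "Sup ?F \<in> V" using finite_pairs by (intro Sup_V) auto
    moreover have "Sup ?F = x" using covered by (intro Sup_pairs) auto
    ultimately show ?thesis by simp
  qed
  show ?R if "x \<in> V"
  proof (rule ccontr)
    assume "\<not> ?R"
    then obtain i where i: "unit i \<in> W" "x i \<noteq> -\<infinity>"
      and no: "\<And>j. unit j \<in> V \<Longrightarrow> pair x i j \<notin> V" by blast
    let ?F = "range (pair x i)"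
    \<comment> \<open>If \<open>unit j\<close> is in \<open>V\<close>, this is the failure of
      \<open>?R\<close> at \<open>i\<close>; otherwise both single-coordinate parts are in
      \<open>W\<close> or trivial.\<close>
    have "pair x i j \<in> W" for j
    proof (cases "unit j \<in> V")
      case True
      then show ?thesis using no pair by blast
    next
      case False
      show ?thesis
      proof (cases "x j = -\<infinity>")
        case True
        then have "pair x i j = pair x i i" by (auto simp: pair_def)
        then show ?thesis using W[OF i] by simp
      next
        assume "x j \<noteq> -\<infinity>"
        then show ?thesis
          using False unit W i by (subst pair_sup) (blast intro: sup_W)
      qed
    qed
    then have "Sup ?F \<in> W" by (intro Sup_W) auto
    moreover have "Sup ?F = x" by (intro Sup_pairs) blast+
    ultimately show False using that disjoint by auto
  qed
qed

text \<open>Invariance under real shifts leaves only the difference \<open>x i - x j\<close> as a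
  parameter when both entries are real, and \<open>unit j \<in> V\<close> makes the set of
  admissible differences down-closed, so \<open>ex_germ_downset\<close> applies.\<close>

lemma ex_germ_pair:
  assumes i: "unit i \<in> W" and j: "unit j \<in> V"
  shows "\<exists>\<alpha>. \<forall>x. (\<forall>k. x k \<in> rmax) \<longrightarrow> x i \<noteq> -\<infinity> \<longrightarrow>
    (pair x i j \<in> V \<longleftrightarrow> Plain (x i) \<le> \<alpha> * Plain (x j))"
proof -
  have ij: "i \<noteq> j" using assms disjoint by auto
  define q where "q s t = (\<lambda>k. if k = i then ereal s else if k = j then ereal t else -\<infinity>)"
    for s t :: real
  define D where "D = {d. q d 0 \<in> V}"
  have q_shift: "(\<lambda>k. ereal r + q s t k) = q (r + s) (r + t)" for r s t
    by (auto simp: q_def)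
  have D: "q s t \<in> V \<longleftrightarrow> s - t \<in> D" for s t
    using shift_V[of "q s t" "- t"] shift_V[of "q (s - t) 0" t] by (auto simp: D_def q_shift)
  have "d' \<in> D" if "d \<in> D" "d' \<le> d" for d d'
  proof -
    \<comment> \<open>Shifting down by \<open>d - d'\<close> gives entry \<open>i\<close> the value
      \<open>d'\<close>; the supremum with \<open>unit j\<close> then raises entry \<open>j\<close>
      back to \<open>0\<close>.\<close>
    have "sup (\<lambda>k. ereal (d' - d) + q d 0 k) (unit j) = q d' 0"
      using that ij by (auto simp: q_def unit_def fun_eq_iff sup_max zero_ereal_def)
    then show ?thesis
      using sup_V[OF shift_V j, of "q d 0" "d' - d"] that by (simp add: D_def)
  qed
  then obtain \<alpha> where \<alpha>: "\<And>s t. Plain (ereal s) \<le> \<alpha> * Plain (ereal t) \<longleftrightarrow> s - t \<in> D"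
    using ex_germ_downset by meson
  have "pair x i j \<in> V \<longleftrightarrow> Plain (x i) \<le> \<alpha> * Plain (x j)"
    if x: "\<forall>k. x k \<in> rmax" and xi: "x i \<noteq> -\<infinity>" for x
  proof -
    obtain s where s: "x i = ereal s"
      using x xi by (cases "x i") (auto simp: rmax_def dest: spec[of _ i])
    show ?thesis
    proof (cases "x j")
      case (real t)
      then have "pair x i j = q s t" using s by (auto simp: pair_def q_def)
      then show ?thesis using s real \<alpha> D by simp
    next
      case PInf
      then show ?thesis using x by (auto simp: rmax_def dest: spec[of _ j])
    next
      case MInf
      \<comment> \<open>Both sides are false here: the restriction is a multiple of
        \<open>unit i\<close>, and the right side of the inequality is -\<infinity>.\<close>
      then have "pair x i j = pair x i i" by (auto simp: pair_def)
      then have "pair x i j \<in> W" using s i by (simp add: pair_same shift_W)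
      then show ?thesis
        using MInf s disjoint by (auto simp: times_germ_def less_eq_germ_def)
    qed
  qed
  then show ?thesis by blast
qed

lemma ex_germ_inequalities:
  "\<exists>\<alpha>. \<forall>x. (\<forall>k. x k \<in> rmax) \<longrightarrow> (\<exists>k. x k \<noteq> -\<infinity>) \<longrightarrow>
    (x \<in> V \<longleftrightarrow> (\<forall>i. unit i \<in> W \<longrightarrow> Plain (x i) \<le> (\<Sum>j\<in>UNIV. \<alpha> i j * Plain (x j))))"
proof -
  obtain \<beta> where \<beta>: "\<And>i j x. unit i \<in> W \<Longrightarrow> unit j \<in> V \<Longrightarrow> \<forall>k. x k \<in> rmax \<Longrightarrow> x i \<noteq> -\<infinity> \<Longrightarrow>
      pair x i j \<in> V \<longleftrightarrow> Plain (x i) \<le> \<beta> i j * Plain (x j)"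
    using ex_germ_pair by metis
  \<comment> \<open>The default \<open>0\<close> removes the indices \<open>j\<close> outside the
    range of the existential in \<open>mem_V_iff\<close> from the sum.\<close>
  define \<alpha> where "\<alpha> i j = (if unit j \<in> V then \<beta> i j else 0)" for i j
  have sum_iff: "Plain (x i) \<le> (\<Sum>j\<in>UNIV. \<alpha> i j * Plain (x j)) \<longleftrightarrow>
      x i = -\<infinity> \<or> (\<exists>j. unit j \<in> V \<and> pair x i j \<in> V)"
    if "\<forall>k. x k \<in> rmax" "unit i \<in> W" for x i
  proof (cases "x i = -\<infinity>")
    case True
    then show ?thesis by (simp add: zero_germ_def[symmetric] germ_zero_le)
  next
    case False
    then have nz: "Plain (x i) \<noteq> 0" by (simp add: zero_germ_def)
    then have "\<not> Plain (x i) \<le> 0" by (metis germ_zero_le order_antisym)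
    then have "Plain (x i) \<le> \<alpha> i j * Plain (x j) \<longleftrightarrow> unit j \<in> V \<and> pair x i j \<in> V" for j
      using \<beta>[OF that(2) _ that(1) False] by (simp add: \<alpha>_def)
    then show ?thesis using False nz by (simp add: le_sum_germ_iff)
  qed
  show ?thesis
  proof (intro exI[of _ \<alpha>] allI impI)
    fix x :: "'m \<Rightarrow> ereal"
    assume x: "\<forall>k. x k \<in> rmax" and "\<exists>k. x k \<noteq> -\<infinity>"
    then obtain k where k: "x k \<noteq> -\<infinity>" by blast
    show "x \<in> V \<longleftrightarrow>
        (\<forall>i. unit i \<in> W \<longrightarrow> Plain (x i) \<le> (\<Sum>j\<in>UNIV. \<alpha> i j * Plain (x j)))"
      unfolding mem_V_iff[OF x k] using sum_iff[OF x] by blast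
  qed
qed

end

section \<open>Homogenization of a hemispace\<close>

text \<open>\<open>None\<close> is the homogenizing coordinate, called the height below. As
  \<infinity> is excluded by the first set, the wildcard case is height -\<infinity>, that is, a
  direction at infinity.\<close>

definition homogenization :: "(ereal ^ 'n) set \<Rightarrow> ('n option \<Rightarrow> ereal) set" where
  "homogenization H = {z. \<forall>k. z k \<in> rmax} \<inter>
    {z. case z None of
          ereal r \<Rightarrow> (\<chi> i. ereal (- r) + z (Some i)) \<in> H
        | _ \<Rightarrow> (\<exists>L. \<forall>l\<ge>L. (\<chi> i. ereal l + z (Some i)) \<in> H)}"

lemma homogenization_real:
  assumes "z None = ereal r"
  shows "z \<in> homogenization H \<longleftrightarrow>
    (\<forall>k. z k \<in> rmax) \<and> (\<chi> i. ereal (- r) + z (Some i)) \<in> H"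
  using assms by (simp add: homogenization_def)

lemma homogenization_MInf:
  assumes "z None = -\<infinity>"
  shows "z \<in> homogenization H \<longleftrightarrow>
    (\<forall>k. z k \<in> rmax) \<and> (\<exists>L. \<forall>l\<ge>L. (\<chi> i. ereal l + z (Some i)) \<in> H)"
  using assms by (simp add: homogenization_def)

lemma rmax_cases:
  assumes "x \<in> rmax"
  obtains r where "x = ereal r" | "x = -\<infinity>"
  using assms by (cases x) (auto simp: rmax_def)

lemma homogenization_rmax: "z \<in> homogenization H \<Longrightarrow> z k \<in> rmax"
  by (simp add: homogenization_def)

lemma homogenization_shift:
  assumes z: "z \<in> homogenization H"
  shows "(\<lambda>k. ereal s + z k) \<in> homogenization H"
proof (cases rule: rmax_cases[OF homogenization_rmax[OF z, of None]])
  case (1 r)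
  have "ereal (- (s + r)) + (ereal s + y) = ereal (- r) + y" for y
    by (cases y) auto
  then show ?thesis
    using z 1 homogenization_real[of z r H]
      homogenization_real[of "\<lambda>k. ereal s + z k" "s + r" H]
    by (auto simp: rmax_def)
next
  case 2
  obtain L where L: "\<forall>l\<ge>L. (\<chi> i. ereal l + z (Some i)) \<in> H"
    using z 2 homogenization_MInf by blast
  have "ereal l + (ereal s + y) = ereal (l + s) + y" for y l
    by (cases y) auto
  then have "\<forall>l\<ge>L - s. (\<chi> i. ereal l + (ereal s + z (Some i))) \<in> H"
    using L by simp
  then show ?thesis
    using z 2 by (auto simp: homogenization_MInf rmax_def)
qed

text \<open>The ordering of the heights makes that of \<open>z\<close> the height of the supremum,
  so \<open>z\<close> can enter the convex combination with weight \<open>0\<close>.\<close>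

lemma homogenization_sup_le:
  assumes H: "tropically_convex H"
    and z: "z \<in> homogenization H" and w: "w \<in> homogenization H" and le: "w None \<le> z None"
  shows "sup z w \<in> homogenization H"
proof -
  have rm: "\<forall>k. sup z w k \<in> rmax"
    using z w by (simp add: sup_max homogenization_rmax max_mem_rmax)
  show ?thesis
  proof (cases rule: rmax_cases[OF homogenization_rmax[OF z, of None]])
    case (1 r)
    let ?z = "\<chi> i. ereal (- r) + z (Some i)"
    have z': "?z \<in> H"
      using z 1 homogenization_real by blast
    \<comment> \<open>A direction at infinity is treated as a point of sufficiently low height \<open>s\<close>.\<close>
    obtain s where s: "s \<le> r" "(\<chi> i. ereal (- s) + w (Some i)) \<in> H"
    proof (cases rule: rmax_cases[OF homogenization_rmax[OF w, of None]])
      case (1 t)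
      then show thesis
        using that[of t] w le \<open>z None = ereal r\<close> homogenization_real by fastforce
    next
      case 2
      then obtain L where "\<forall>l\<ge>L. (\<chi> i. ereal l + w (Some i)) \<in> H"
        using w homogenization_MInf by blast
      moreover obtain m where "m \<ge> L" "m \<ge> - r"
        using max.cobounded1 max.cobounded2 by blast
      ultimately show thesis
        using that[of "- m"] by simp
    qed
    \<comment> \<open>The weight \<open>s - r \<le> 0\<close> converts normalization of
      \<open>w\<close> at height \<open>s\<close> into normalization at the common height
      \<open>r\<close>.\<close>
    have "ereal (s - r) + (ereal (- s) + y) = ereal (- r) + y" for y
      by (cases y) auto
    then have "(\<chi> i. max (ereal (- r) + z (Some i)) (ereal (- r) + w (Some i))) \<in> H"
      using tropically_convexD[OF H z' s(2), of 0 "ereal (s - r)"] s(1)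
      by (simp add: rmax_def max_def)
    moreover have "max (ereal (- r) + x) (ereal (- r) + y) = ereal (- r) + max x y" for x y
      by (cases x; cases y) (auto simp: max_def)
    moreover have "sup z w None = ereal r"
      using 1 le by (simp add: sup_max max_absorb1)
    ultimately show ?thesis
      using rm homogenization_real[of "sup z w" r H] by (simp add: sup_max)
  next
    case 2
    then have 3: "w None = -\<infinity>" using le by simp
    obtain L where L: "\<forall>l\<ge>L. (\<chi> i. ereal l + z (Some i)) \<in> H"
      using z 2 homogenization_MInf by blast
    obtain M where M: "\<forall>l\<ge>M. (\<chi> i. ereal l + w (Some i)) \<in> H"
      using w 3 homogenization_MInf by blast
    have "(\<chi> i. ereal l + max (z (Some i)) (w (Some i))) \<in> H" if "l \<ge> max L M" for l
    proof -
      have "max (ereal l + x) (ereal l + y) = ereal l + max x y" for x y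
        by (cases x; cases y) (auto simp: max_def)
      then show ?thesis
        using tropically_convexD[OF H, of "\<chi> i. ereal l + z (Some i)"
            "\<chi> i. ereal l + w (Some i)" 0 0] L M that
        by (simp add: rmax_def)
    qed
    then have "\<exists>L. \<forall>l\<ge>L. (\<chi> i. ereal l + max (z (Some i)) (w (Some i))) \<in> H"
      by blast
    then show ?thesis
      using rm 2 3 homogenization_MInf[of "sup z w" H] by (simp add: sup_max)
  qed
qed

lemma homogenization_sup:
  assumes "tropically_convex H" "z \<in> homogenization H" "w \<in> homogenization H"
  shows "sup z w \<in> homogenization H"
  using homogenization_sup_le[OF assms] homogenization_sup_le[OF assms(1,3,2)]
  by (metis linorder_linear sup_commute)

text \<open>A convex set meets the ray in an interval: for \<open>L \<le> l \<le> m\<close>, the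
  point at \<open>l\<close> is the maximum of the point at \<open>L\<close> and the point at
  \<open>m\<close> with weight \<open>l - m\<close>.\<close>

lemma eventually_mem_ray:
  assumes H: "tropically_convex H" and freq: "\<And>L. \<exists>l\<ge>L. (\<chi> i. ereal l + y i) \<in> H"
  shows "\<exists>L. \<forall>l\<ge>L. (\<chi> i. ereal l + y i) \<in> H"
proof -
  obtain L where L: "(\<chi> i. ereal L + y i) \<in> H" using freq by blast
  have "(\<chi> i. ereal l + y i) \<in> H" if "l \<ge> L" for l
  proof -
    obtain m where m: "m \<ge> l" "(\<chi> i. ereal m + y i) \<in> H" using freq by blast
    have "max (0 + (ereal L + u)) (ereal (l - m) + (ereal m + u)) = ereal l + u" for u
      using that by (cases u) (auto simp: max_def)
    then show ?thesis
      using tropically_convexD[OF H L m(2), of 0 "ereal (l - m)"] m(1)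
      by (simp add: rmax_def max_def)
  qed
  then show ?thesis by blast
qed

lemma complementary_cones_homogenization:
  fixes H :: "(ereal ^ 'n) set"
  assumes "tropical_hemispace H"
  shows "complementary_cones (homogenization H) (homogenization (rmax_space - H))"
proof
  have conv: "tropically_convex H" "tropically_convex (rmax_space - H)"
    using assms by (auto simp: tropical_hemispace_def)
  have space: "(\<chi> i. ereal l + z (Some i)) \<in> rmax_space" if "\<forall>k. z k \<in> rmax"
    for z :: "'n option \<Rightarrow> ereal" and l
    using that by (simp add: rmax_space_def rmax_def)
  show "z \<in> homogenization H \<or> z \<in> homogenization (rmax_space - H)" if "\<forall>k. z k \<in> rmax" for z
  proof (cases rule: rmax_cases[OF that[rule_format, of None]])
    case (1 r)
    then show ?thesis using that space by (simp add: homogenization_real)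
  next
    case 2
    show ?thesis
    proof (rule disjCI)
      \<comment> \<open>Not being eventually in the complement means meeting \<open>H\<close> at
        arbitrarily large \<open>l\<close>, which convexity upgrades to being eventually in
        \<open>H\<close>.\<close>
      assume "z \<notin> homogenization (rmax_space - H)"
      then have "\<And>L. \<exists>l\<ge>L. (\<chi> i. ereal l + z (Some i)) \<in> H"
        using that 2 space by (simp add: homogenization_MInf)
      then show "z \<in> homogenization H"
        using eventually_mem_ray[OF conv(1)] that 2 by (simp add: homogenization_MInf)
    qed
  qed
  show "homogenization H \<inter> homogenization (rmax_space - H) = {}"
  proof (rule equals0I)
    fix z assume "z \<in> homogenization H \<inter> homogenization (rmax_space - H)"
    then have z: "z \<in> homogenization H" "z \<in> homogenization (rmax_space - H)" by auto
    show False
    proof (cases rule: rmax_cases[OF homogenization_rmax[OF z(1), of None]])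
      case (1 r)
      then show ?thesis using z by (simp add: homogenization_real)
    next
      case 2
      then obtain L M where "\<forall>l\<ge>L. (\<chi> i. ereal l + z (Some i)) \<in> H"
        "\<forall>l\<ge>M. (\<chi> i. ereal l + z (Some i)) \<in> rmax_space - H"
        using z by (auto simp: homogenization_MInf)
      then show ?thesis by (metis DiffD2 max.cobounded1 max.cobounded2)
    qed
  qed
qed (use assms in \<open>auto simp: tropical_hemispace_def intro: homogenization_sup homogenization_shift\<close>)

section \<open>Hemispaces are mixed polyhedra\<close>

lemma sum_option:
  "(\<Sum>j\<in>UNIV. f j) = f None + (\<Sum>i\<in>UNIV. f (Some i))"
  for f :: "'n :: finite option \<Rightarrow> 'a :: comm_monoid_add"
  by (simp add: UNIV_option_conv sum.reindex)

lemma mixed_polyhedron_hemispace: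
  fixes H :: "(ereal ^ 'n) set"
  assumes H: "tropical_hemispace H"
  shows "mixed_polyhedron H"
proof -
  define V W where "V = homogenization H" and "W = homogenization (rmax_space - H)"
  interpret complementary_cones V W
    unfolding V_def W_def by (rule complementary_cones_homogenization[OF H])
  obtain \<alpha> where \<alpha>: "\<And>z. \<forall>k. z k \<in> rmax \<Longrightarrow> \<exists>k. z k \<noteq> -\<infinity> \<Longrightarrow>
      z \<in> V \<longleftrightarrow> (\<forall>i. unit i \<in> W \<longrightarrow> Plain (z i) \<le> (\<Sum>j\<in>UNIV. \<alpha> i j * Plain (z j)))"
    using ex_germ_inequalities by metis
  \<comment> \<open>The left side is the affine form that reads off homogeneous coordinate
    \<open>i\<close>; the coefficients at \<open>None\<close> become the constant terms.\<close>
  define ineq :: "'n option \<Rightarrow> ereal \<times> (ereal ^ 'n) \<times> germ \<times> (germ ^ 'n)" where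
    "ineq i = (unit i None, \<chi> k. unit i (Some k), \<alpha> i None, \<chi> k. \<alpha> i (Some k))" for i
  let ?I = "ineq ` {i. unit i \<in> W}"
  have unit_rmax: "unit i k \<in> rmax" for i k
    by (simp add: unit_def rmax_def)
  have iff: "x \<in> H \<longleftrightarrow> (\<forall>(a0, a, b0, b)\<in>?I. sat_mixed_ineq a0 a b0 b x)" if x: "x \<in> rmax_space" for x
  proof -
    \<comment> \<open>The point \<open>x\<close> is placed at height \<open>0\<close>, the tropical
      one; this real entry also keeps \<open>z\<close> away from the vector with all entries
      -\<infinity>.\<close>
    define z where "z = (\<lambda>k. case k of None \<Rightarrow> 0 | Some i \<Rightarrow> x $ i)"
    have z: "z None = 0" "z (Some i) = x $ i" for i
      by (simp_all add: z_def)
    have zr: "\<forall>k. z k \<in> rmax"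
      using x by (auto simp: z_def rmax_space_def rmax_def split: option.split)
    have affine: "(\<Sum>j\<in>UNIV. f j * Plain (z j)) = f None + (\<Sum>i\<in>UNIV. f (Some i) * Plain (x $ i))"
      for f :: "'n option \<Rightarrow> germ"
      by (simp add: sum_option z one_germ_def[symmetric])
    have "(\<Sum>j\<in>UNIV. Plain (unit i j) * Plain (z j)) = (\<Sum>j\<in>UNIV. if j = i then Plain (z j) else 0)" for i
      by (rule sum.cong)
         (auto simp: unit_def one_germ_def[symmetric] zero_germ_def[symmetric])
    then have "(\<Sum>j\<in>UNIV. Plain (unit i j) * Plain (z j)) = Plain (z i)" for i
      by simp
    then have coord: "Plain (z i) =
        Plain (unit i None) + (\<Sum>k\<in>UNIV. Plain (unit i (Some k)) * Plain (x $ k))" for i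
      by (metis affine[of "\<lambda>j. Plain (unit i j)"])
    have "x \<in> H \<longleftrightarrow> z \<in> V"
      using zr homogenization_real[of z 0 H] by (simp add: V_def z zero_ereal_def[symmetric])
    also have "\<dots> \<longleftrightarrow>
        (\<forall>i. unit i \<in> W \<longrightarrow> Plain (z i) \<le> (\<Sum>j\<in>UNIV. \<alpha> i j * Plain (z j)))"
      using zr z(1) by (intro \<alpha>) (auto intro!: exI[of _ None])
    also have "\<dots> \<longleftrightarrow> (\<forall>(a0, a, b0, b)\<in>?I. sat_mixed_ineq a0 a b0 b x)"
      \<comment> \<open>\<open>affine\<close> comes first because \<open>coord\<close> would also
        rewrite the terms \<open>Plain (z j)\<close> under the sum.\<close>
      unfolding affine unfolding coord by (simp add: ineq_def sat_mixed_ineq_def)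
    finally show ?thesis .
  qed
  have "H \<subseteq> rmax_space"
    using H by (simp add: tropical_hemispace_def tropically_convex_def)
  then have "H = {x \<in> rmax_space. P x}" if "\<And>x. x \<in> rmax_space \<Longrightarrow> x \<in> H \<longleftrightarrow> P x" for P
    using that by blast
  from this[OF iff] have "H = {x \<in> rmax_space. \<forall>(a0, a, b0, b)\<in>?I. sat_mixed_ineq a0 a b0 b x}" .
  moreover have "finite ?I" "\<forall>(a0, a, b0, b)\<in>?I. a0 \<in> rmax \<and> a \<in> rmax_space"
    by (auto simp: ineq_def rmax_space_def unit_rmax)
  ultimately show ?thesis
    unfolding mixed_polyhedron_def by (intro exI[of _ ?I] conjI)
qed

lemma mixed_polyhedron_rmax_space: "mixed_polyhedron rmax_space"
  unfolding mixed_polyhedron_def by (intro exI[of _ "{}"]) simp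

lemma mixed_polyhedron_Int:
  assumes "mixed_polyhedron P" "mixed_polyhedron Q"
  shows "mixed_polyhedron (P \<inter> Q)"
proof -
  from assms(1) obtain I where I: "finite I"
    "\<forall>(a0, a, b0, b)\<in>I. a0 \<in> rmax \<and> a \<in> rmax_space"
    "P = {x \<in> rmax_space. \<forall>(a0, a, b0, b)\<in>I. sat_mixed_ineq a0 a b0 b x}"
    unfolding mixed_polyhedron_def by (elim exE conjE)
  from assms(2) obtain J where J: "finite J"
    "\<forall>(a0, a, b0, b)\<in>J. a0 \<in> rmax \<and> a \<in> rmax_space"
    "Q = {x \<in> rmax_space. \<forall>(a0, a, b0, b)\<in>J. sat_mixed_ineq a0 a b0 b x}"
    unfolding mixed_polyhedron_def by (elim exE conjE)
  have "P \<inter> Q = {x \<in> rmax_space. \<forall>(a0, a, b0, b)\<in>I \<union> J. sat_mixed_ineq a0 a b0 b x}"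
    unfolding I(3) J(3) ball_Un by (intro set_eqI) (simp only: Int_iff mem_Collect_eq conj_ac conj_left_absorb)
  then show ?thesis
    unfolding mixed_polyhedron_def
    using I(1,2) J(1,2) by (intro exI[of _ "I \<union> J"] conjI) (simp_all only: ball_Un finite_Un simp_thms)
qed

text \<open>Intersecting with \<open>rmax_space\<close> lets the empty family stand for the whole
  space, which is also the solution set of the empty system of inequalities.\<close>

theorem corollary17:
  fixes S :: "(ereal ^ 'n) set"
  assumes "S \<subseteq> rmax_space"
  shows "mixed_polyhedron S \<longleftrightarrow>
    (\<exists>\<H>. finite \<H> \<and> (\<forall>H\<in>\<H>. tropical_hemispace H) \<and> S = rmax_space \<inter> \<Inter>\<H>)"
proof
  assume "mixed_polyhedron S"
  then obtain I where I: "finite I" "\<forall>(a0, a, b0, b)\<in>I. a0 \<in> rmax \<and> a \<in> rmax_space"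
    "S = {x \<in> rmax_space. \<forall>(a0, a, b0, b)\<in>I. sat_mixed_ineq a0 a b0 b x}"
    unfolding mixed_polyhedron_def by (elim exE conjE)
  let ?\<H> = "(\<lambda>(a0, a, b0, b). {x \<in> rmax_space. sat_mixed_ineq a0 a b0 b x}) ` I"
  have "finite ?\<H>" "\<forall>H\<in>?\<H>. tropical_hemispace H"
    using I by (auto intro!: tropical_hemispace_mixed_ineq)
  moreover have "S = rmax_space \<inter> \<Inter>?\<H>"
    unfolding I(3) by auto
  ultimately show "\<exists>\<H>. finite \<H> \<and> (\<forall>H\<in>\<H>. tropical_hemispace H) \<and> S = rmax_space \<inter> \<Inter>\<H>"
    by blast
next
  assume "\<exists>\<H>. finite \<H> \<and> (\<forall>H\<in>\<H>. tropical_hemispace H) \<and> S = rmax_space \<inter> \<Inter>\<H>"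
  then obtain \<H> where \<H>: "finite \<H>" "\<forall>H\<in>\<H>. tropical_hemispace H" "S = rmax_space \<inter> \<Inter>\<H>"
    by blast
  from \<H>(1,2) have "mixed_polyhedron (rmax_space \<inter> \<Inter>\<H>)"
  proof (induction \<H> rule: finite_induct)
    case empty
    then show ?case by (simp add: mixed_polyhedron_rmax_space)
  next
    case (insert H \<H>)
    then have "mixed_polyhedron (H \<inter> (rmax_space \<inter> \<Inter>\<H>))"
      by (intro mixed_polyhedron_Int[of H]) (auto intro: mixed_polyhedron_hemispace)
    then show ?case by (simp add: Int_left_commute)
  qed
  then show "mixed_polyhedron S" using \<H>(3) by simp
qed

end
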